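(* Let $V$ be a complex Hilbert space and let $\mathfrak{a} \colon V \times V \to \mathbb{C}$ be a continuous sesquilinear form which is compactly elliptic. Define the operator $\mathcal{A} \colon V \to V'$ by $\mathfrak{a}(u,v) = (\mathcal{A}u, v)_{V' \times V}$ for all $u,v \in V$. Suppose that $\mathcal{A}$ is injective. Then $\mathcal{A}$ is invertible.
   Context: Sesquilinear forms are linear in the first and antilinear in the second variable, and $\mathfrak{a}(u) := \mathfrak{a}(u,u)$. $V'$ denotes the (anti)dual of $V$, i.e. the space of continuous antilinear functionals on $V$, with duality pairing $(\cdot,\cdot)_{V' \times V}$. $\mathcal{L}(X,Y)$ denotes the bounded linear operators from $X$ to $Y$. Given a Hilbert space $\widetilde{H}$ and $\tilde{j} \in \mathcal{L}(V,\widetilde{H})$, the form $\mathfrak{a}$ is called $\tilde{j}$-elliptic if there are $\omega \in \mathbb{R}$ and $\mu > 0$ such that $\mathrm{Re}\, \mathfrak{a}(u) + \omega \|\tilde{j}(u)\|_{\widetilde{H}}^2 \geq \mu \|u\|_V^2$ for all $u \in V$. The form $\mathfrak{a}$ is called compactly elliptic if there exist a Hilbert space $\widetilde{H}$ and a compact $\tilde{j} \in \mathcal{L}(V,\widetilde{H})$ such that $\mathfrak{a}$ is $\tilde{j}$-elliptic. *)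

theory Defs
  imports "HOL-Analysis.Analysis"
begin

class complex_vector = real_vector +
  fixes scaleC :: "complex \<Rightarrow> 'a \<Rightarrow> 'a"  (infixr "*\<^sub>C" 75)
  assumes scaleC_add_right: "c *\<^sub>C (x + y) = c *\<^sub>C x + c *\<^sub>C y"
    and scaleC_add_left: "(c + d) *\<^sub>C x = c *\<^sub>C x + d *\<^sub>C x"
    and scaleC_scaleC: "c *\<^sub>C d *\<^sub>C x = (c * d) *\<^sub>C x"
    and scaleC_of_real: "complex_of_real r *\<^sub>C x = r *\<^sub>R x"

class complex_normed_vector = complex_vector + real_normed_vector +
  assumes norm_scaleC: "norm (c *\<^sub>C x) = cmod c * norm x"

text \<open>The complex inner product is linear in its first argument. Its real part is the
  real inner product of the underlying class, so that the norm is the one induced by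
  \<open>cinner\<close>, and positive definiteness is inherited from \<^class>\<open>real_inner\<close>
  (\<open>cinner x x\<close> is real by conjugate symmetry).\<close>

class complex_inner = complex_vector + real_inner +
  fixes cinner :: "'a \<Rightarrow> 'a \<Rightarrow> complex"
  assumes cinner_commute: "cinner x y = cnj (cinner y x)"
    and cinner_add_left: "cinner (x + y) z = cinner x z + cinner y z"
    and cinner_scaleC_left: "cinner (c *\<^sub>C x) y = c * cinner x y"
    and Re_cinner: "Re (cinner x y) = inner x y"
begin

lemma cinner_self: "cinner x x = complex_of_real ((norm x)\<^sup>2)"
proof (rule complex_eqI)
  show "Re (cinner x x) = Re (complex_of_real ((norm x)\<^sup>2))"
    by (simp add: Re_cinner power2_norm_eq_inner)
  have "Im (cinner x x) = - Im (cinner x x)"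
    using arg_cong[OF cinner_commute[of x x], of Im] by simp
  then show "Im (cinner x x) = Im (complex_of_real ((norm x)\<^sup>2))"
    by simp
qed

subclass complex_normed_vector
proof
  fix c :: complex and x :: 'a
  have "cinner (c *\<^sub>C x) (c *\<^sub>C x) = c * cnj (c * cinner x x)"
    by (metis cinner_commute cinner_scaleC_left)
  also have "\<dots> = complex_of_real ((cmod c * norm x)\<^sup>2)"
    by (simp only: complex_cnj_mult cinner_self complex_cnj_complex_of_real
        mult.assoc[symmetric] complex_norm_square[symmetric] power_mult_distrib of_real_mult)
  finally have "(norm (c *\<^sub>C x))\<^sup>2 = (cmod c * norm x)\<^sup>2"
    by (simp only: cinner_self of_real_eq_iff)
  then show "norm (c *\<^sub>C x) = cmod c * norm x"
    by (simp add: power2_eq_iff_nonneg)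
qed

end

class complex_hilbert_space = complex_inner + complete_space

instantiation complex :: complex_hilbert_space
begin
definition scaleC_complex :: "complex \<Rightarrow> complex \<Rightarrow> complex"
  where "scaleC_complex c x = c * x"
definition cinner_complex :: "complex \<Rightarrow> complex \<Rightarrow> complex"
  where "cinner_complex x y = x * cnj y"
instance
  by standard
    (auto simp: scaleC_complex_def cinner_complex_def algebra_simps inner_complex_def scaleR_conv_of_real)
end

definition bounded_clinear :: "('a::complex_normed_vector \<Rightarrow> 'b::complex_normed_vector) \<Rightarrow> bool"
  where "bounded_clinear T \<longleftrightarrow> bounded_linear T \<and> (\<forall>c x. T (c *\<^sub>C x) = c *\<^sub>C T x)"

definition invertible_operator :: "('a::complex_normed_vector \<Rightarrow> 'b::complex_normed_vector) \<Rightarrow> bool"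
  where "invertible_operator T \<longleftrightarrow>
    bounded_clinear T \<and> (\<exists>S. bounded_clinear S \<and> (\<forall>x. S (T x) = x) \<and> (\<forall>y. T (S y) = y))"

definition compact_operator :: "('a::complex_normed_vector \<Rightarrow> 'b::complex_normed_vector) \<Rightarrow> bool"
  where "compact_operator T \<longleftrightarrow>
    bounded_clinear T \<and> (\<forall>B. bounded B \<longrightarrow> compact (closure (T ` B)))"


text \<open>The antidual \<open>V'\<close>: continuous antilinear functionals with the operator norm.
  An antilinear functional is in particular real-linear, so it is carved out of the bounded
  real-linear maps into \<open>\<complex>\<close>. The duality pairing is \<open>antidual_apply\<close>.\<close>

typedef (overloaded) 'v antidual =
  "{f :: 'v::complex_normed_vector \<Rightarrow>\<^sub>L complex. \<forall>c v. blinfun_apply f (c *\<^sub>C v) = cnj c * blinfun_apply f v}"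
  morphisms blinfun_of_antidual Abs_antidual
  by (rule exI[of _ 0]) simp

setup_lifting type_definition_antidual

lift_definition antidual_apply :: "'v::complex_normed_vector antidual \<Rightarrow> 'v \<Rightarrow> complex"
  is blinfun_apply .

instantiation antidual :: (complex_normed_vector) complex_normed_vector
begin

lift_definition zero_antidual :: "'a antidual" is 0 by simp
lift_definition plus_antidual :: "'a antidual \<Rightarrow> 'a antidual \<Rightarrow> 'a antidual" is "(+)"
  by (simp add: blinfun.add_left distrib_left)
lift_definition minus_antidual :: "'a antidual \<Rightarrow> 'a antidual \<Rightarrow> 'a antidual" is "(-)"
  by (simp add: blinfun.diff_left right_diff_distrib)
lift_definition uminus_antidual :: "'a antidual \<Rightarrow> 'a antidual" is uminus
  by (simp add: blinfun.minus_left)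
lift_definition scaleR_antidual :: "real \<Rightarrow> 'a antidual \<Rightarrow> 'a antidual" is scaleR
  by (simp add: blinfun.scaleR_left)
lift_definition scaleC_antidual :: "complex \<Rightarrow> 'a antidual \<Rightarrow> 'a antidual"
  is "\<lambda>c f. blinfun_mult_right c o\<^sub>L f"
  by simp
lift_definition norm_antidual :: "'a antidual \<Rightarrow> real" is norm .

definition dist_antidual :: "'a antidual \<Rightarrow> 'a antidual \<Rightarrow> real"
  where "dist_antidual f g = norm (f - g)"
definition sgn_antidual :: "'a antidual \<Rightarrow> 'a antidual"
  where "sgn_antidual f = scaleR (inverse (norm f)) f"
definition uniformity_antidual :: "('a antidual \<times> 'a antidual) filter"
  where "uniformity_antidual = (INF e\<in>{0<..}. principal {(f, g). dist f g < e})"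
definition open_antidual :: "'a antidual set \<Rightarrow> bool"
  where "open_antidual U = (\<forall>f\<in>U. \<forall>\<^sub>F (f', g) in uniformity. f' = f \<longrightarrow> g \<in> U)"

instance
proof
  fix f g h :: "'a antidual" and r s :: real and c d :: complex
  show "f + g + h = f + (g + h)" "f + g = g + f" "0 + f = f" "- f + f = 0" "f - g = f + - g"
    by (transfer, simp)+
  show "r *\<^sub>R (f + g) = r *\<^sub>R f + r *\<^sub>R g" "(r + s) *\<^sub>R f = r *\<^sub>R f + s *\<^sub>R f"
    "r *\<^sub>R s *\<^sub>R f = (r * s) *\<^sub>R f" "1 *\<^sub>R f = f"
    by (transfer, simp add: scaleR_add_right scaleR_add_left)+
  show "c *\<^sub>C (f + g) = c *\<^sub>C f + c *\<^sub>C g" "(c + d) *\<^sub>C f = c *\<^sub>C f + d *\<^sub>C f"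
    "c *\<^sub>C d *\<^sub>C f = (c * d) *\<^sub>C f" "complex_of_real r *\<^sub>C f = r *\<^sub>R f"
    by (transfer, rule blinfun_eqI,
        simp add: blinfun.add_left blinfun.scaleR_left algebra_simps scaleR_conv_of_real)+
  show "dist f g = norm (f - g)" by (rule dist_antidual_def)
  show "sgn f = scaleR (inverse (norm f)) f" by (rule sgn_antidual_def)
  show "uniformity = (INF e\<in>{0<..}. principal {(f, g :: 'a antidual). dist f g < e})"
    by (rule uniformity_antidual_def)
  show "open U = (\<forall>f\<in>U. \<forall>\<^sub>F (f', g) in uniformity. f' = f \<longrightarrow> g \<in> U)" for U :: "'a antidual set"
    by (rule open_antidual_def)
  show "norm f = 0 \<longleftrightarrow> f = 0" by (transfer, simp)
  show "norm (f + g) \<le> norm f + norm g" by (transfer, rule norm_triangle_ineq)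
  show "norm (r *\<^sub>R f) = \<bar>r\<bar> * norm f" by (transfer, simp)
  show "norm (c *\<^sub>C f) = cmod c * norm f"
  proof transfer
    fix c :: complex and f :: "'a \<Rightarrow>\<^sub>L complex"
    show "norm (blinfun_mult_right c o\<^sub>L f) = cmod c * norm f"
    proof (cases "c = 0")
      case True
      then have "blinfun_mult_right c o\<^sub>L f = 0" by (intro blinfun_eqI) simp
      with True show ?thesis by simp
    next
      case False
      have le: "norm (blinfun_mult_right d o\<^sub>L g) \<le> cmod d * norm g" for d and g :: "'a \<Rightarrow>\<^sub>L complex"
        by (rule norm_blinfun_bound)
          (auto simp: norm_mult mult.assoc intro!: mult_left_mono norm_blinfun)
      have "blinfun_mult_right (inverse c) o\<^sub>L (blinfun_mult_right c o\<^sub>L f) = f"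
        using False by (intro blinfun_eqI) simp
      then have "norm f \<le> cmod (inverse c) * norm (blinfun_mult_right c o\<^sub>L f)"
        by (metis le)
      then have "cmod c * norm f \<le> norm (blinfun_mult_right c o\<^sub>L f)"
        using False by (simp add: norm_inverse inverse_eq_divide norm_divide field_simps)
      with le[of c f] show ?thesis by simp
    qed
  qed
qed

end


definition sesquilinear :: "('v::complex_vector \<Rightarrow> 'v \<Rightarrow> complex) \<Rightarrow> bool"
  where "sesquilinear a \<longleftrightarrow>
    (\<forall>u u' v. a (u + u') v = a u v + a u' v) \<and>
    (\<forall>c u v. a (c *\<^sub>C u) v = c * a u v) \<and>
    (\<forall>u v v'. a u (v + v') = a u v + a u v') \<and>
    (\<forall>c u v. a u (c *\<^sub>C v) = cnj c * a u v)"

definition continuous_form :: "('v::complex_normed_vector \<Rightarrow> 'v \<Rightarrow> complex) \<Rightarrow> bool"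
  where "continuous_form a \<longleftrightarrow> continuous_on UNIV (\<lambda>(u, v). a u v)"

definition elliptic_wrt ::
    "('v::complex_hilbert_space \<Rightarrow> 'h::complex_hilbert_space) \<Rightarrow> ('v \<Rightarrow> 'v \<Rightarrow> complex) \<Rightarrow> bool"
  where "elliptic_wrt j a \<longleftrightarrow>
    (\<exists>\<omega> \<mu> :: real. \<mu> > 0 \<and>
      (\<forall>u. Re (a u u) + \<omega> * (norm (j u))\<^sup>2 \<ge> \<mu> * (norm u)\<^sup>2))"

text \<open>HOL cannot quantify over types inside a formula, so the auxiliary Hilbert space is a type
  argument. In a theorem assuming \<open>compactly_elliptic TYPE('h) a\<close>, the type variable \<open>'h\<close> is
  universally quantified, which amounts to an existential over all Hilbert spaces in the premise.\<close>

definition compactly_elliptic ::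
    "'h::complex_hilbert_space itself \<Rightarrow> ('v::complex_hilbert_space \<Rightarrow> 'v \<Rightarrow> complex) \<Rightarrow> bool"
  where "compactly_elliptic _ a \<longleftrightarrow>
    (\<exists>j :: 'v \<Rightarrow> 'h. compact_operator j \<and> elliptic_wrt j a)"

lemma ex1_form_operator:
  fixes a :: "'v::complex_normed_vector \<Rightarrow> 'v \<Rightarrow> complex"
  assumes "sesquilinear a" and "continuous_form a"
  shows "\<exists>!A :: 'v \<Rightarrow> 'v antidual. \<forall>u v. a u v = antidual_apply (A u) v"
proof -
  have "\<exists>f :: 'v antidual. \<forall>v. a u v = antidual_apply f v" for u
  proof -
    have add: "a u (v + v') = a u v + a u v'" and scaleC: "a u (c *\<^sub>C v) = cnj c * a u v" for c v v'
      using assms(1) by (auto simp: sesquilinear_def)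
    have scaleR: "a u (r *\<^sub>R v) = r *\<^sub>R a u v" for r v
      using scaleC[of "complex_of_real r" v] by (simp add: scaleC_of_real scaleR_conv_of_real)
    have zero: "a u 0 = 0" using scaleR[of 0 0] by simp
    have "continuous_on UNIV ((\<lambda>(u, v). a u v) \<circ> (\<lambda>v. (u, v)))"
      using assms(2) unfolding continuous_form_def
      by (intro continuous_on_compose continuous_intros) (auto elim: continuous_on_subset)
    then have "isCont (a u) 0"
      by (simp add: o_def continuous_on_eq_continuous_at)
    then obtain d where d: "d > 0" "\<And>v. norm v < d \<Longrightarrow> cmod (a u v) < 1"
      unfolding continuous_at_eps_delta by (force simp: zero dist_norm dest: spec[of _ 1])
    have "bounded_linear (a u)"
    proof (rule bounded_linear_intro)
      show "a u (v + v') = a u v + a u v'" for v v' by (rule add)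
      show "a u (r *\<^sub>R v) = r *\<^sub>R a u v" for r v by (rule scaleR)
      show "cmod (a u v) \<le> norm v * (2 / d)" for v
      proof (cases "v = 0")
        case False
        define r where "r = d / (2 * norm v)"
        have r: "r > 0" using False d(1) by (simp add: r_def)
        have "norm (r *\<^sub>R v) < d" using False d(1) by (simp add: r_def)
        then have "r * cmod (a u v) < 1" using d(2)[of "r *\<^sub>R v"] r by (simp add: scaleR)
        then show ?thesis using False d(1) by (simp add: r_def field_simps)
      qed (simp add: zero)
    qed
    then have *: "blinfun_apply (Blinfun (a u)) = a u" by (rule bounded_linear_Blinfun_apply)
    then have "antidual_apply (Abs_antidual (Blinfun (a u))) v = a u v" for v
      by (simp add: antidual_apply.rep_eq Abs_antidual_inverse scaleC)
    then show ?thesis by metis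
  qed
  then obtain A :: "'v \<Rightarrow> 'v antidual" where A: "\<forall>u v. a u v = antidual_apply (A u) v" by metis
  have inj: "f = g" if "antidual_apply f = antidual_apply g" for f g :: "'v antidual"
    using that by transfer (simp add: blinfun_apply_inject)
  show ?thesis
  proof (rule ex1I[of _ A], rule A, rule ext)
    fix B u assume "\<forall>u v. a u v = antidual_apply (B u) v"
    with A show "B u = A u" by (intro inj ext) metis
  qed
qed

end

theory Submission
  imports Defs
begin

text \<open>Everything happens on the underlying real Hilbert space. An antilinear functional is
  determined by its real part, so the equation \<open>A u = \<phi>\<close> is equivalent to the real variational
  equation \<open>Re (a u v) = Re (\<phi> v)\<close> for all \<open>v\<close>. The Riesz representation theorem turns this
  into \<open>T u = f\<close>, where \<open>T\<close> is the bounded operator with \<open>inner (T u) v = Re (a u v)\<close>.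

  Let \<open>J\<close> be the adjoint of the compact map \<open>j\<close>. Ellipticity says precisely that
  \<open>B = T + \<omega> J j\<close> is coercive; hence \<open>B\<close> is boundedly invertible by the Lax--Milgram lemma, and
  \<open>T = B (I - K)\<close> with the compact operator \<open>K = \<omega> B\<^sup>-\<^sup>1 J j\<close>. Since \<open>A\<close> is injective, so is
  \<open>I - K\<close>, and by Riesz's theory of compact operators \<open>I - K\<close> is bounded below and onto. The
  same then holds for \<open>T\<close>, and both properties pass to \<open>A\<close>; being bounded below is what makes
  the inverse continuous.\<close>

section \<open>Representation of functionals and bilinear forms\<close>

text \<open>The functional \<open>q v = \<parallel>v\<parallel>\<^sup>2 - 2 f v\<close> is bounded below, by the parallelogram law its
  minimising sequences are Cauchy, and its Euler--Lagrange equation is \<open>f w = inner v w\<close>.\<close>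

lemma riesz_representation:
  fixes f :: "'a::{real_inner,complete_space} \<Rightarrow> real"
  assumes "bounded_linear f"
  shows "\<exists>v. \<forall>w. f w = inner v w"
proof -
  interpret f: bounded_linear f by fact
  define q where "q v = (norm v)\<^sup>2 - 2 * f v" for v
  define m where "m = Inf (range q)"
  obtain N where N: "\<And>v. norm (f v) \<le> norm v * N" using f.bounded by blast
  have "- N\<^sup>2 \<le> q v" for v
  proof -
    have "f v \<le> norm v * N" using N[of v] by simp
    moreover have "0 \<le> (norm v - N)\<^sup>2" by simp
    ultimately show ?thesis by (simp add: q_def power2_diff)
  qed
  then have "bdd_below (range q)" by (intro bdd_belowI) auto
  then have m_le: "m \<le> q v" for v unfolding m_def by (intro cInf_lower) auto
  have "\<exists>v. q v < m + inverse (real (Suc n))" for n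
    using cInf_lessD[of "range q" "m + inverse (real (Suc n))"] by (auto simp: m_def)
  then obtain x where x: "\<And>n. q (x n) < m + inverse (real (Suc n))" by metis
  have parallelogram: "(norm (u - v))\<^sup>2 = 2 * q u + 2 * q v - 4 * q ((1/2) *\<^sub>R (u + v))" for u v
    by (simp add: q_def power2_norm_eq_inner f.add f.scaleR inner_add_left inner_add_right
        inner_diff_left inner_diff_right inner_commute algebra_simps)
  have "Cauchy x"
    unfolding Cauchy_def
  proof (intro allI impI)
    fix e :: real assume "e > 0"
    then obtain M where M: "inverse (real (Suc M)) < e\<^sup>2 / 4"
      using reals_Archimedean[of "e\<^sup>2 / 4"] by auto
    show "\<exists>M. \<forall>k\<ge>M. \<forall>n\<ge>M. dist (x k) (x n) < e"
    proof (intro exI[of _ M] allI impI)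
      fix k n assume "M \<le> k" "M \<le> n"
      then have "inverse (real (Suc k)) \<le> inverse (real (Suc M))"
        "inverse (real (Suc n)) \<le> inverse (real (Suc M))"
        by (auto intro!: le_imp_inverse_le)
      then have "(norm (x k - x n))\<^sup>2 < e\<^sup>2"
        using parallelogram[of "x k" "x n"] M x[of k] x[of n] m_le[of "(1/2) *\<^sub>R (x k + x n)"]
        by linarith
      then show "dist (x k) (x n) < e"
        using \<open>e > 0\<close> by (simp add: dist_norm power2_less_imp_less)
    qed
  qed
  then obtain v where v: "x \<longlonglongrightarrow> v" by (auto simp: Cauchy_convergent_iff convergent_def)
  have "(\<lambda>n. q (x n)) \<longlonglongrightarrow> q v"
    unfolding q_def by (intro tendsto_intros f.tendsto v)
  moreover have "(\<lambda>n. m + inverse (real (Suc n))) \<longlonglongrightarrow> m + 0"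
    by (intro tendsto_intros LIMSEQ_inverse_real_of_nat)
  ultimately have "q v \<le> m + 0"
    by (rule LIMSEQ_le) (use x less_imp_le in blast)
  then have min: "q v \<le> q w" for w using m_le[of w] by simp
  have "f w = inner v w" for w
  proof -
    define d where "d = inner v w - f w"
    define s where "s = (norm w)\<^sup>2 + 1"
    have s: "s > 0" by (simp add: s_def add_nonneg_pos)
    have "q (v + t *\<^sub>R w) = q v + 2 * t * d + t\<^sup>2 * (s - 1)" for t
      by (simp add: q_def d_def s_def power2_norm_eq_inner f.add f.scaleR inner_add_left
          inner_add_right inner_commute)
        (simp add: power2_eq_square algebra_simps)
    \<comment> \<open>The shift by one in \<open>s\<close> makes this step length meaningful also for \<open>w = 0\<close>.\<close>
    from this[of "- d / s"] min[of "v + (- d / s) *\<^sub>R w"]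
    have "0 \<le> 2 * (- d / s) * d + (- d / s)\<^sup>2 * (s - 1)" by simp
    also have "\<dots> = - (d\<^sup>2 * (s + 1)) / s\<^sup>2"
      using s by (simp add: field_simps power2_eq_square)
    finally have "d\<^sup>2 * (s + 1) \<le> 0" using s by (simp add: field_simps)
    then have "d = 0" using s by (simp add: mult_le_0_iff)
    then show ?thesis by (simp add: d_def)
  qed
  then show ?thesis by blast
qed

text \<open>With two different spaces this also provides adjoints of bounded operators.\<close>

lemma bounded_bilinear_form_representation:
  fixes b :: "'a::real_normed_vector \<Rightarrow> 'b::{real_inner,complete_space} \<Rightarrow> real"
  assumes "bounded_bilinear b"
  shows "\<exists>T. bounded_linear T \<and> (\<forall>u v. b u v = inner (T u) v)"
proof -
  interpret b: bounded_bilinear b by fact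
  have "\<exists>t. \<forall>v. b u v = inner t v" for u
    by (rule riesz_representation) (rule b.bounded_linear_right)
  then obtain T where T: "\<And>u v. b u v = inner (T u) v" by metis
  obtain M where M: "0 \<le> M" "\<And>u v. norm (b u v) \<le> norm u * norm v * M"
    using b.nonneg_bounded by auto
  have eqI: "x = y" if "\<And>v. inner x v = inner y v" for x y :: 'b
    by (meson that vector_eq_rdot)
  have "bounded_linear T"
  proof (rule bounded_linear_intro)
    show "T (x + y) = T x + T y" for x y
      by (rule eqI) (simp add: inner_add_left b.add_left flip: T)
    show "T (r *\<^sub>R x) = r *\<^sub>R T x" for r x
      by (rule eqI) (simp add: b.scaleR_left flip: T)
    show "norm (T x) \<le> norm x * M" for x
    proof (cases "T x = 0")
      case False
      have "norm (T x) * norm (T x) = b x (T x)"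
        by (simp add: T flip: power2_eq_square power2_norm_eq_inner)
      also have "\<dots> \<le> norm x * M * norm (T x)" using M(2)[of x "T x"] by (simp add: ac_simps)
      finally show ?thesis using False by simp
    qed (use M in simp)
  qed
  with T show ?thesis by blast
qed

section \<open>Operators that are bounded below\<close>

lemma bounded_below_surj_has_bounded_inverse:
  fixes f :: "'a::real_normed_vector \<Rightarrow> 'b::real_normed_vector"
  assumes "bounded_linear f" "c > 0" "\<And>x. c * norm x \<le> norm (f x)" "surj f"
  shows "\<exists>g. bounded_linear g \<and> (\<forall>x. g (f x) = x) \<and> (\<forall>y. f (g y) = y)"
proof -
  interpret f: bounded_linear f by fact
  have inj: "x = y" if "f x = f y" for x y
    using assms(2) assms(3)[of "x - y"] that by (simp add: f.diff mult_le_0_iff)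
  obtain g where g: "\<And>y. f (g y) = y" using assms(4) by (metis surj_def)
  have "bounded_linear g"
  proof (rule bounded_linear_intro)
    show "g (x + y) = g x + g y" for x y by (rule inj) (simp add: f.add g)
    show "g (r *\<^sub>R x) = r *\<^sub>R g x" for r x by (rule inj) (simp add: f.scaleR g)
    show "norm (g x) \<le> norm x * (1 / c)" for x
      using assms(2) assms(3)[of "g x"] by (simp add: g field_simps)
  qed
  with g inj show ?thesis by metis
qed

lemma coercive_bounded_below:
  fixes B :: "'a::real_inner \<Rightarrow> 'a"
  assumes "\<mu> * (norm u)\<^sup>2 \<le> inner (B u) u"
  shows "\<mu> * norm u \<le> norm (B u)"
proof (cases "u = 0")
  case False
  have "\<mu> * norm u * norm u \<le> norm (B u) * norm u"
    using assms norm_cauchy_schwarz[of "B u" u] by (simp add: power2_eq_square)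
  with False show ?thesis by simp
qed simp

text \<open>The Lax--Milgram lemma: for a suitable step length \<open>\<rho>\<close> the map \<open>u \<mapsto> u - \<rho> (B u - y)\<close> is a
  contraction, and its fixed point solves \<open>B u = y\<close>.\<close>

lemma coercive_surj:
  fixes B :: "'a::{real_inner,complete_space} \<Rightarrow> 'a"
  assumes "bounded_linear B" "\<mu> > 0" and coercive: "\<And>u. \<mu> * (norm u)\<^sup>2 \<le> inner (B u) u"
  shows "surj B"
  unfolding surj_def
proof
  fix y
  interpret B: bounded_linear B by fact
  obtain M0 where M0: "M0 > 0" "\<And>u. norm (B u) \<le> norm u * M0" using B.pos_bounded by blast
  \<comment> \<open>The operator bound is enlarged so that it exceeds \<open>\<mu>\<close>, also on the zero space.\<close>
  define M where "M = M0 + \<mu>"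
  define \<rho> where "\<rho> = \<mu> / M\<^sup>2"
  define k where "k = sqrt (1 - (\<mu> / M)\<^sup>2)"
  have M: "M > 0" "\<mu> < M" using M0 assms(2) by (auto simp: M_def)
  have bd: "norm (B u) \<le> M * norm u" for u
    using add_mono[OF M0(2) mult_nonneg_nonneg[OF less_imp_le[OF assms(2)] norm_ge_zero], of u u]
    by (simp add: M_def distrib_left distrib_right mult.commute)
  have "\<mu> / M < 1" "0 < \<mu> / M" using M assms(2) by auto
  then have "(\<mu> / M)\<^sup>2 < 1" "0 < (\<mu> / M)\<^sup>2" by (auto simp: power_less_one_iff)
  then have k: "0 \<le> k" "k < 1" "k\<^sup>2 = 1 - (\<mu> / M)\<^sup>2" by (auto simp: k_def)
  have contr: "norm (u - \<rho> *\<^sub>R B u) \<le> k * norm u" for u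
  proof (rule power2_le_imp_le)
    have "\<rho> \<ge> 0" using assms(2) by (simp add: \<rho>_def)
    have "(norm (u - \<rho> *\<^sub>R B u))\<^sup>2 = (norm u)\<^sup>2 - 2 * (\<rho> * inner (B u) u) + \<rho>\<^sup>2 * (norm (B u))\<^sup>2"
      by (simp add: power2_norm_eq_inner inner_diff_left inner_diff_right inner_commute)
        (simp add: power2_eq_square algebra_simps)
    also have "\<dots> \<le> (norm u)\<^sup>2 - 2 * (\<rho> * (\<mu> * (norm u)\<^sup>2)) + \<rho>\<^sup>2 * (M * norm u)\<^sup>2"
      using mult_left_mono[OF coercive \<open>\<rho> \<ge> 0\<close>, of u]
        mult_left_mono[OF power_mono[OF bd[of u], of 2], of "\<rho>\<^sup>2"] by simp
    also have "\<dots> = (k * norm u)\<^sup>2"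
      unfolding power_mult_distrib k(3)
      using M(1) by (simp add: \<rho>_def field_simps power2_eq_square)
    finally show "(norm (u - \<rho> *\<^sub>R B u))\<^sup>2 \<le> (k * norm u)\<^sup>2" .
  qed (use k in simp)
  define F where "F u = u - \<rho> *\<^sub>R (B u - y)" for u
  have "dist (F u) (F v) \<le> k * dist u v" for u v
  proof -
    have "F u - F v = (u - v) - \<rho> *\<^sub>R B (u - v)" by (simp add: F_def B.diff algebra_simps)
    then show ?thesis using contr[of "u - v"] by (simp add: dist_norm)
  qed
  then have "\<exists>!u. F u = u" by (intro banach_fix_type[OF k(1,2)]) auto
  then obtain u where "F u = u" by blast
  moreover have "\<rho> \<noteq> 0" using assms(2) M by (simp add: \<rho>_def)
  ultimately have "y = B u" by (simp add: F_def)
  then show "\<exists>u. y = B u" ..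
qed

section \<open>Compact perturbations of the identity\<close>

text \<open>Riesz's lemma, a substitute for orthogonality that needs no inner product.\<close>

lemma riesz_lemma:
  fixes W :: "'a::real_normed_vector set"
  assumes "subspace W" "closed W" "x \<notin> W" "subspace U" "W \<subseteq> U" "x \<in> U"
  shows "\<exists>e\<in>U. norm e = 1 \<and> (\<forall>w\<in>W. 1/2 \<le> norm (e - w))"
proof -
  have "W \<noteq> {}" using assms(1) subspace_0 by auto
  then have d: "infdist x W > 0"
    using assms(2,3) infdist_nonneg[of x W] in_closed_iff_infdist_zero[of W x] by linarith
  obtain w0 where w0: "w0 \<in> W" "dist x w0 < 2 * infdist x W"
  proof -
    have "\<exists>w0\<in>W. dist x w0 < 2 * infdist x W"
      using cINF_less_iff[OF \<open>W \<noteq> {}\<close>, of "dist x" "2 * infdist x W"] d \<open>W \<noteq> {}\<close>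
      by (auto simp: infdist_def)
    with that show thesis by blast
  qed
  define s where "s = norm (x - w0)"
  have s: "s > 0" using w0(1) assms(3) by (auto simp: s_def)
  define e where "e = (1 / s) *\<^sub>R (x - w0)"
  have "e \<in> U" unfolding e_def
    using assms w0 by (intro subspace_scale subspace_diff) auto
  moreover have "norm e = 1" using s by (simp add: e_def flip: s_def)
  moreover have "1/2 \<le> norm (e - w)" if "w \<in> W" for w
  proof -
    have "w0 + s *\<^sub>R w \<in> W" using that w0 assms(1) by (intro subspace_add subspace_scale) auto
    then have "infdist x W \<le> norm (x - (w0 + s *\<^sub>R w))"
      using infdist_le by (metis dist_norm)
    also have "x - (w0 + s *\<^sub>R w) = s *\<^sub>R (e - w)" using s by (simp add: e_def algebra_simps)
    finally have "infdist x W \<le> s * norm (e - w)" using s by simp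
    moreover have "s < 2 * infdist x W" using w0(2) by (simp add: s_def dist_norm)
    ultimately have "s * (1/2) < s * norm (e - w)" by linarith
    then show ?thesis using s by simp
  qed
  ultimately show ?thesis by blast
qed

text \<open>If there were no such constant, there would be unit vectors \<open>x n\<close> with
  \<open>x n - K (x n) \<longlonglongrightarrow> 0\<close>. Along a subsequence \<open>K (x n)\<close> converges, hence so does \<open>x n\<close>, and the
  limit is a unit vector in the kernel of \<open>I - K\<close>.\<close>

lemma injective_id_minus_compact_bounded_below:
  fixes K :: "'a::real_normed_vector \<Rightarrow> 'a"
  assumes "bounded_linear K"
    and compact: "\<And>x::nat \<Rightarrow> 'a. bounded (range x) \<Longrightarrow> \<exists>l r. strict_mono r \<and> (\<lambda>n. K (x (r n))) \<longlonglongrightarrow> l"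
    and inj: "\<And>x. x - K x = 0 \<Longrightarrow> x = 0"
  shows "\<exists>c>0. \<forall>x. c * norm x \<le> norm (x - K x)"
proof (rule ccontr)
  interpret K: bounded_linear K by fact
  assume neg: "\<not> ?thesis"
  have "\<exists>x. norm x = 1 \<and> norm (x - K x) < inverse (real (Suc n))" for n
  proof -
    obtain x where x: "norm (x - K x) < inverse (real (Suc n)) * norm x"
      using neg by (metis inverse_positive_iff_positive not_le of_nat_0_less_iff zero_less_Suc)
    then have "x \<noteq> 0" by (auto simp: K.zero)
    have "norm (sgn x - K (sgn x)) = norm (x - K x) / norm x"
      by (simp add: sgn_div_norm K.scaleR divide_inverse mult.commute flip: scaleR_diff_right)
    with x \<open>x \<noteq> 0\<close> have "norm (sgn x - K (sgn x)) < inverse (real (Suc n))"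
      by (simp add: pos_divide_less_eq)
    with \<open>x \<noteq> 0\<close> show ?thesis by (intro exI[of _ "sgn x"]) (simp add: norm_sgn)
  qed
  then obtain x where x: "\<And>n. norm (x n) = 1" "\<And>n. norm (x n - K (x n)) < inverse (real (Suc n))"
    by metis
  have "bounded (range x)" by (intro boundedI[of _ 1]) (auto simp: x)
  then obtain l r where r: "strict_mono r" and l: "(\<lambda>n. K (x (r n))) \<longlonglongrightarrow> l"
    using compact by blast
  have "(\<lambda>n. x n - K (x n)) \<longlonglongrightarrow> 0"
    by (rule tendsto_0_le[OF LIMSEQ_inverse_real_of_nat, where K=1])
      (use x(2) in \<open>auto intro!: always_eventually less_imp_le\<close>)
  from LIMSEQ_subseq_LIMSEQ[OF this r]
  have 0: "(\<lambda>n. x (r n) - K (x (r n))) \<longlonglongrightarrow> 0" by (simp add: o_def)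
  from tendsto_add[OF this l] have xl: "(\<lambda>n. x (r n)) \<longlonglongrightarrow> l" by simp
  have "(\<lambda>n. x (r n) - K (x (r n))) \<longlonglongrightarrow> l - K l"
    by (intro tendsto_diff xl K.tendsto)
  with 0 have "l = 0" using inj LIMSEQ_unique by blast
  moreover have "norm l = 1" using tendsto_norm[OF xl] by (simp add: x(1) LIMSEQ_const_iff)
  ultimately show False by simp
qed

text \<open>Put \<open>S = I - K\<close>. If \<open>S\<close> were not onto, the ranges of its powers would form a strictly
  decreasing sequence of closed subspaces. For almost orthogonal unit vectors \<open>e n\<close> in successive
  ones, \<open>K (e n) - K (e m)\<close> with \<open>n < m\<close> differs from \<open>e n\<close> by an element of the next subspace,
  so that the \<open>K (e n)\<close> are uniformly separated, against compactness.\<close>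

lemma injective_id_minus_compact_surj:
  fixes K :: "'a::{real_normed_vector,complete_space} \<Rightarrow> 'a"
  assumes K: "bounded_linear K"
    and compact: "\<And>x::nat \<Rightarrow> 'a. bounded (range x) \<Longrightarrow> \<exists>l r. strict_mono r \<and> (\<lambda>n. K (x (r n))) \<longlonglongrightarrow> l"
    and inj: "\<And>x. x - K x = 0 \<Longrightarrow> x = 0"
  shows "surj (\<lambda>x. x - K x)"
proof (rule ccontr)
  interpret K: bounded_linear K by fact
  define S where "S x = x - K x" for x
  assume "\<not> surj (\<lambda>x. x - K x)"
  then obtain z where z: "z \<notin> range S" by (auto simp: S_def)
  have S: "bounded_linear S"
    unfolding S_def by (intro bounded_linear_sub bounded_linear_ident K)
  then interpret S: bounded_linear S .
  have "x = y" if "S x = S y" for x y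
    using inj[of "x - y"] that by (simp add: S_def K.diff algebra_simps)
  then have "inj S" by (rule injI)
  have "\<exists>c>0. \<forall>x. c * norm x \<le> norm (x - K x)"
    by (rule injective_id_minus_compact_bounded_below) (fact K compact inj)+
  then obtain c where c: "c > 0" "\<And>x. c * norm x \<le> norm (S x)"
    by (auto simp: S_def)
  have Sn: "bounded_linear (S ^^ n)" for n
    by (induction n) (auto simp: bounded_linear_compose[OF S] o_def id_def bounded_linear_ident)
  have below: "c ^ n * norm x \<le> norm ((S ^^ n) x)" for n x
  proof (induction n)
    case (Suc n)
    have "c ^ Suc n * norm x \<le> c * norm ((S ^^ n) x)"
      using Suc c(1) by (simp add: mult.assoc)
    also have "\<dots> \<le> norm ((S ^^ Suc n) x)" using c(2) by simp
    finally show ?case .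
  qed simp
  define V where "V n = range (S ^^ n)" for n
  have sub: "subspace (V n)" for n
    unfolding V_def
    by (intro linear_subspace_image subspace_UNIV bounded_linear.linear Sn)
  have cl: "closed (V n)" for n
    unfolding V_def
    by (intro complete_imp_closed complete_isometric_image[of "c ^ n"])
      (use c(1) below Sn in \<open>auto simp: complete_UNIV\<close>)
  have V_Suc: "S x \<in> V (Suc n)" if "x \<in> V n" for x n
    using that by (auto simp: V_def image_iff)
  have V_mono: "V n \<subseteq> V m" if "m \<le> n" for m n
    using that
  proof (rule lift_Suc_antimono_le[of V, rotated])
    show "V (Suc n) \<subseteq> V n" for n unfolding V_def funpow_Suc_right by auto
  qed
  have "\<exists>e\<in>V n. norm e = 1 \<and> (\<forall>w\<in>V (Suc n). 1/2 \<le> norm (e - w))" for n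
  proof (rule riesz_lemma[OF sub cl _ sub])
    have "inj (S ^^ n)" using \<open>inj S\<close> by (rule inj_fn)
    then show "(S ^^ n) z \<notin> V (Suc n)"
      using z unfolding V_def funpow_Suc_right by (auto dest: injD)
    show "V (Suc n) \<subseteq> V n" by (rule V_mono) simp
    show "(S ^^ n) z \<in> V n" by (simp add: V_def)
  qed
  then obtain e where e: "\<And>n. e n \<in> V n" "\<And>n. norm (e n) = 1"
    "\<And>n w. w \<in> V (Suc n) \<Longrightarrow> 1/2 \<le> norm (e n - w)" by metis
  have separated: "1/2 \<le> norm (K (e n) - K (e m))" if "n < m" for n m
  proof -
    have "e m \<in> V (Suc n)" using e(1) V_mono[of "Suc n" m] that by auto
    moreover have "S (e m) \<in> V (Suc n)"
      using V_Suc[OF e(1), of m] V_mono[of "Suc n" "Suc m"] that by auto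
    ultimately have "S (e n) + e m - S (e m) \<in> V (Suc n)"
      using V_Suc[OF e(1), of n] by (intro subspace_diff subspace_add sub)
    moreover have "K (e n) - K (e m) = e n - (S (e n) + e m - S (e m))" by (simp add: S_def)
    ultimately show ?thesis using e(3) by simp
  qed
  have "bounded (range e)" by (intro boundedI[of _ 1]) (auto simp: e)
  then obtain l r where r: "strict_mono r" and "(\<lambda>n. K (e (r n))) \<longlonglongrightarrow> l"
    using compact by blast
  then have "Cauchy (\<lambda>n. K (e (r n)))" by (intro LIMSEQ_imp_Cauchy)
  then obtain M where "\<And>m n. m \<ge> M \<Longrightarrow> n \<ge> M \<Longrightarrow> dist (K (e (r m))) (K (e (r n))) < 1/2"
    by (metis Cauchy_def half_gt_zero_iff zero_less_one)
  from this[of M "Suc M"] separated[of "r M" "r (Suc M)"] r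
  show False by (simp add: dist_norm strict_mono_less)
qed

section \<open>Operators that are coercive up to a compact term\<close>

text \<open>With the adjoint \<open>J\<close> of \<open>j\<close>, the ellipticity estimate is coercivity of \<open>B = T + \<omega> J j\<close>, and
  \<open>T = B (I - K)\<close> for \<open>K = B\<^sup>-\<^sup>1 (\<omega> J j)\<close>. As \<open>K\<close> factors through \<open>j\<close>, it inherits its compactness.\<close>

lemma coercive_modulo_compact_injective_imp_bounded_below_surj:
  fixes T :: "'v::{real_inner,complete_space} \<Rightarrow> 'v" and j :: "'v \<Rightarrow> 'h::real_inner"
  assumes T: "bounded_linear T" and j: "bounded_linear j"
    and compact: "\<And>x::nat \<Rightarrow> 'v. bounded (range x) \<Longrightarrow> \<exists>l r. strict_mono r \<and> (\<lambda>n. j (x (r n))) \<longlonglongrightarrow> l"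
    and "\<mu> > 0" and elliptic: "\<And>u. \<mu> * (norm u)\<^sup>2 \<le> inner (T u) u + \<omega> * (norm (j u))\<^sup>2"
    and inj: "\<And>u. T u = 0 \<Longrightarrow> u = 0"
  shows "surj T \<and> (\<exists>c>0. \<forall>u. c * norm u \<le> norm (T u))"
proof -
  interpret T: bounded_linear T by fact
  have "bounded_bilinear (\<lambda>h v. inner h (j v))"
    by (rule bounded_bilinear.comp[OF bounded_bilinear_inner bounded_linear_ident j])
  then obtain J where J: "bounded_linear J" "\<And>h v. inner h (j v) = inner (J h) v"
    using bounded_bilinear_form_representation[of "\<lambda>h v. inner h (j v)"] by blast
  define B where "B u = T u + \<omega> *\<^sub>R J (j u)" for u
  have B: "bounded_linear B" unfolding B_def
    by (intro bounded_linear_add T bounded_linear_compose[OF bounded_linear_scaleR_right]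
        bounded_linear_compose[OF J(1)] j)
  interpret B: bounded_linear B by fact
  have coercive: "\<mu> * (norm u)\<^sup>2 \<le> inner (B u) u" for u
    using elliptic[of u] by (simp add: B_def inner_add_left power2_norm_eq_inner flip: J(2))
  have below: "\<mu> * norm u \<le> norm (B u)" for u
    using coercive by (rule coercive_bounded_below)
  have "surj B" by (rule coercive_surj) (fact B \<open>\<mu> > 0\<close> coercive)+
  with B \<open>\<mu> > 0\<close> below obtain B' where B': "bounded_linear B'"
    "\<And>u. B' (B u) = u" "\<And>y. B (B' y) = y"
    using bounded_below_surj_has_bounded_inverse[of B \<mu>] by blast
  interpret B': bounded_linear B' by fact
  define K where "K u = B' (\<omega> *\<^sub>R J (j u))" for u
  have K: "bounded_linear K" unfolding K_def
    by (intro bounded_linear_compose[OF B'(1)] bounded_linear_compose[OF bounded_linear_scaleR_right]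
        bounded_linear_compose[OF J(1)] j)
  have K_compact: "\<exists>l r. strict_mono r \<and> (\<lambda>n. K (x (r n))) \<longlonglongrightarrow> l"
    if bdd: "bounded (range x)" for x :: "nat \<Rightarrow> 'v"
  proof -
    obtain l r where "strict_mono r" "(\<lambda>n. j (x (r n))) \<longlonglongrightarrow> l" using compact bdd by blast
    then have "(\<lambda>n. K (x (r n))) \<longlonglongrightarrow> B' (\<omega> *\<^sub>R J l)"
      unfolding K_def by (intro B'.tendsto tendsto_scaleR tendsto_const bounded_linear.tendsto[OF J(1)])
    with \<open>strict_mono r\<close> show ?thesis by blast
  qed
  have T_eq: "T u = B (u - K u)" for u by (simp add: B.diff K_def B'(3)) (simp add: B_def)
  have K_inj: "u = 0" if "u - K u = 0" for u
    using inj[of u] that T_eq[of u] B.zero by simp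
  have K_surj: "surj (\<lambda>u. u - K u)"
    by (rule injective_id_minus_compact_surj) (fact K K_compact K_inj)+
  have "\<exists>c>0. \<forall>u. c * norm u \<le> norm (u - K u)"
    by (rule injective_id_minus_compact_bounded_below) (fact K K_compact K_inj)+
  then obtain c where c: "c > 0" "\<And>u. c * norm u \<le> norm (u - K u)" by blast
  have "surj T"
    using comp_surj[OF K_surj \<open>surj B\<close>] by (simp add: T_eq[abs_def] o_def)
  moreover have "\<mu> * c * norm u \<le> norm (T u)" for u
    using order_trans[OF mult_left_mono[OF c(2)] below] \<open>\<mu> > 0\<close>
    by (simp add: T_eq mult.assoc)
  ultimately show ?thesis using \<open>\<mu> > 0\<close> c(1) by (meson mult_pos_pos)
qed

section \<open>Sesquilinear forms and antilinear functionals\<close>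

lemma antidual_apply_bounded_linear: "bounded_linear (antidual_apply f)"
  by transfer (rule blinfun.bounded_linear_right)

lemma norm_antidual_apply_le: "cmod (antidual_apply f v) \<le> norm f * norm v"
  by transfer (rule norm_blinfun)

lemma antidual_apply_scaleC: "antidual_apply f (c *\<^sub>C v) = cnj c * antidual_apply f v"
  by transfer simp

text \<open>The imaginary part of an antilinear functional is recovered from its real part at
  \<open>\<i> v\<close>.\<close>

lemma antidual_eqI_Re:
  assumes "\<And>v. Re (antidual_apply f v) = Re (antidual_apply g v)"
  shows "f = g"
proof -
  have "antidual_apply f v = antidual_apply g v" for v
    using assms[of v] assms[of "\<i> *\<^sub>C v"] by (simp add: antidual_apply_scaleC complex_eq_iff)
  then show ?thesis by transfer (rule blinfun_eqI)
qed

lemma norm_antidual_le: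
  assumes "M \<ge> 0" "\<And>v. cmod (antidual_apply f v) \<le> M * norm v"
  shows "norm f \<le> M"
  using assms by transfer (rule norm_blinfun_bound)

text \<open>Continuity at the origin bounds \<open>a\<close> by \<open>1\<close> on small vectors; scaling both arguments
  independently gives the bilinear estimate.\<close>

lemma continuous_sesquilinear_bounded:
  fixes a :: "'v::complex_normed_vector \<Rightarrow> 'v \<Rightarrow> complex"
  assumes "sesquilinear a" "continuous_form a"
  shows "\<exists>M\<ge>0. \<forall>u v. cmod (a u v) \<le> M * norm u * norm v"
proof -
  have scaleR: "a (r *\<^sub>R u) (s *\<^sub>R v) = of_real (r * s) * a u v" for r s u v
    using assms(1) unfolding sesquilinear_def
    by (metis complex_cnj_complex_of_real mult.assoc of_real_mult scaleC_of_real)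
  have zero_left: "a 0 v = 0" and zero_right: "a v 0 = 0" for v
    using scaleR[of 0 0 1 v] scaleR[of 1 v 0 0] by auto
  have "isCont (\<lambda>(u, v). a u v) (0, 0)"
    using assms(2) by (simp add: continuous_form_def continuous_on_eq_continuous_at)
  then obtain d where d: "d > 0" "\<And>p. dist p (0, 0) < d \<Longrightarrow> dist (case p of (u, v) \<Rightarrow> a u v) (a 0 0) < 1"
    unfolding continuous_at_eps_delta by (force dest: spec[of _ 1])
  define s where "s = d / 2"
  have s: "s > 0" using d(1) by (simp add: s_def)
  have small: "cmod (a u v) \<le> 1" if "norm u = s / 2" "norm v = s / 2" for u v
  proof -
    have "dist (u, v) (0, 0) \<le> norm u + norm v"
      by (simp add: dist_Pair_Pair sqrt_sum_squares_le_sum)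
    also have "\<dots> < d" using that d(1) by (simp add: s_def)
    finally show ?thesis using d(2)[of "(u, v)"] by (simp add: zero_left)
  qed
  have "cmod (a u v) \<le> 4 / s\<^sup>2 * norm u * norm v" for u v
  proof (cases "u = 0 \<or> v = 0")
    case False
    have "cmod (a ((s / (2 * norm u)) *\<^sub>R u) ((s / (2 * norm v)) *\<^sub>R v)) \<le> 1"
      using False s by (intro small) auto
    then show ?thesis
      using False s by (simp add: scaleR norm_mult norm_divide norm_power field_simps power2_eq_square)
  qed (auto simp: zero_left zero_right)
  then show ?thesis by (intro exI[of _ "4 / s\<^sup>2"]) auto
qed

theorem lemma4p1:
  fixes a :: "'v::complex_hilbert_space \<Rightarrow> 'v \<Rightarrow> complex"
    and A :: "'v \<Rightarrow> 'v antidual"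
  assumes "sesquilinear a" and "continuous_form a"
    and "compactly_elliptic TYPE('h::complex_hilbert_space) a"
    and "\<And>u v. a u v = antidual_apply (A u) v"
    and "inj A"
  shows "invertible_operator A"
proof -
  note A = assms(4)
  have add_left: "a (u + u') v = a u v + a u' v" and scaleC_left: "a (c *\<^sub>C u) v = c * a u v"
    and add_right: "a u (v + v') = a u v + a u v'" for u u' v v' c
    using assms(1) by (auto simp: sesquilinear_def)
  have scaleR_left: "a (r *\<^sub>R u) v = of_real r * a u v" for r u v
    using scaleC_left[of "of_real r"] by (simp add: scaleC_of_real)
  have scaleR_right: "a u (r *\<^sub>R v) = of_real r * a u v" for r u v
    using antidual_apply_scaleC[of "A u" "of_real r" v] by (simp add: A scaleC_of_real)
  obtain M where M: "M \<ge> 0" "\<And>u v. cmod (a u v) \<le> M * norm u * norm v"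
    using continuous_sesquilinear_bounded[OF assms(1,2)] by blast
  obtain j :: "'v \<Rightarrow> 'h" and \<omega> \<mu> where cj: "compact_operator j" and "\<mu> > 0"
    and elliptic: "\<And>u. \<mu> * (norm u)\<^sup>2 \<le> Re (a u u) + \<omega> * (norm (j u))\<^sup>2"
    using assms(3) by (auto simp: compactly_elliptic_def elliptic_wrt_def)
  have j: "bounded_linear j" using cj by (simp add: compact_operator_def bounded_clinear_def)

  have plus: "antidual_apply (f + g) v = antidual_apply f v + antidual_apply g v"
    and scaleC: "antidual_apply (c *\<^sub>C f) v = c * antidual_apply f v"
    for f g :: "'v antidual" and c v
    by (transfer, simp add: blinfun.add_left)+
  have A_add: "A (u + u') = A u + A u'" for u u'
    by (rule antidual_eqI_Re) (simp add: plus add_left flip: A)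
  have A_scaleC: "A (c *\<^sub>C u) = c *\<^sub>C A u" for c u
    by (rule antidual_eqI_Re) (simp add: scaleC scaleC_left flip: A)
  have A_bl: "bounded_linear A"
  proof (rule bounded_linear_intro)
    show "A (u + v) = A u + A v" for u v by (rule A_add)
    show "A (r *\<^sub>R u) = r *\<^sub>R A u" for r u
      using A_scaleC[of "of_real r" u] by (simp add: scaleC_of_real)
    show "norm (A u) \<le> norm u * M" for u
      by (rule norm_antidual_le) (use M in \<open>auto simp: mult.commute simp flip: A\<close>)
  qed
  interpret A: bounded_linear A by fact

  have "bounded_bilinear (\<lambda>u v. Re (a u v))"
  proof
    show "\<exists>K. \<forall>u v. norm (Re (a u v)) \<le> norm u * norm v * K"
      using M(2) abs_Re_le_cmod order_trans
      by (intro exI[of _ M]) (fastforce simp: ac_simps)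
  qed (simp_all add: add_left add_right scaleR_left scaleR_right)
  then obtain T where T: "bounded_linear T" "\<And>u v. Re (a u v) = inner (T u) v"
    using bounded_bilinear_form_representation[of "\<lambda>u v. Re (a u v)"] by blast

  have "surj T \<and> (\<exists>c>0. \<forall>u. c * norm u \<le> norm (T u))"
  proof (rule coercive_modulo_compact_injective_imp_bounded_below_surj[OF T(1) j _ \<open>\<mu> > 0\<close>])
    show "\<mu> * (norm u)\<^sup>2 \<le> inner (T u) u + \<omega> * (norm (j u))\<^sup>2" for u
      using elliptic[of u] by (simp add: T(2))
    show "u = 0" if "T u = 0" for u
    proof -
      have "A u = A 0"
        by (rule antidual_eqI_Re) (simp add: T(2) that linear_0[OF bounded_linear.linear[OF T(1)]] del: A.zero flip: A)
      with \<open>inj A\<close> show ?thesis by (rule injD)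
    qed
    fix x :: "nat \<Rightarrow> 'v" assume "bounded (range x)"
    then have "compact (closure (j ` range x))" using cj by (simp add: compact_operator_def)
    moreover have "\<forall>n. j (x n) \<in> closure (j ` range x)"
      by (intro allI subsetD[OF closure_subset]) simp
    ultimately obtain l r where "strict_mono r" "((\<lambda>n. j (x n)) \<circ> r) \<longlonglongrightarrow> l"
      by (meson compact_imp_seq_compact seq_compactE)
    then show "\<exists>l r. strict_mono r \<and> (\<lambda>n. j (x (r n))) \<longlonglongrightarrow> l"
      by (auto simp: o_def)
  qed
  then obtain c where "surj T" and c: "c > 0" "\<And>u. c * norm u \<le> norm (T u)" by blast

  \<comment> \<open>Solve for the representer of the real part of \<open>\<phi>\<close>; the imaginary part then agrees as well.\<close>
  have "surj A"
    unfolding surj_def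
  proof
    fix \<phi> :: "'v antidual"
    have "bounded_linear (\<lambda>v. Re (antidual_apply \<phi> v))"
      by (rule bounded_linear_compose[OF bounded_linear_Re antidual_apply_bounded_linear])
    then obtain f where f: "\<And>v. Re (antidual_apply \<phi> v) = inner f v"
      using riesz_representation by blast
    obtain u where "f = T u" using \<open>surj T\<close> by (metis surj_def)
    then have "\<phi> = A u" by (intro antidual_eqI_Re) (simp add: f T(2) flip: A)
    then show "\<exists>u. \<phi> = A u" ..
  qed
  \<comment> \<open>Testing \<open>A u\<close> with \<open>T u\<close> shows that \<open>A\<close> inherits the lower bound of \<open>T\<close>.\<close>
  moreover have "c * norm u \<le> norm (A u)" for u
  proof -
    have "norm (T u) * norm (T u) = Re (a u (T u))"
      by (simp add: T(2) flip: power2_eq_square power2_norm_eq_inner)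
    also have "\<dots> \<le> norm (A u) * norm (T u)"
      using norm_antidual_apply_le[of "A u" "T u"] complex_Re_le_cmod order_trans
      by (metis A)
    finally have "norm (T u) \<le> norm (A u)"
      by (cases "T u = 0") auto
    with c(2)[of u] show ?thesis by simp
  qed
  ultimately obtain S where S: "bounded_linear S" "\<And>u. S (A u) = u" "\<And>f. A (S f) = f"
    using bounded_below_surj_has_bounded_inverse[OF A_bl c(1)] by blast
  have "S (k *\<^sub>C f) = k *\<^sub>C S f" for k f
    using S(2)[of "k *\<^sub>C S f"] by (simp add: A_scaleC S(3))
  with S A_bl A_scaleC show ?thesis
    unfolding invertible_operator_def bounded_clinear_def by blast
qed

end
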